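(* Let $\mathscr{B}\subseteq\mathbb{R}^2$ be a set of points $(y,z)$ with $y\ge0$, $z>0$, let $\mathscr{D}=\{y/z:(y,z)\in\mathscr{B}\}$, let $\ell\ge1$, $\theta_0\in(0,\frac\pi2)$ with $\mathscr{D}\subseteq[0,\tan\theta_0)$, and $\theta_k=\theta_0/2^k$ for $k=1,\dots,\ell$. Let $\phi$ be a real-valued increasing function on a subset of $\mathbb{R}$ containing $[0,\tan\theta_0]$, and $\psi(y,z)=\phi(y/z)$. If the constants $\mathscr{M}_k$ and $\mathscr{N}_{\boldsymbol\omega}$ are sufficiently large, then $$\operatorname{proj}_{\left(r=\frac yz,\,f\right)}\left(\operatorname{BNStep}_{\{\theta_k\}}(\psi)\right)=\operatorname{step}_{\{b_k\}}(\phi),$$ where the breakpoints are the numbers $\tan(\theta_0-\mathscr{Q}(\boldsymbol\omega)\theta_\ell)$, $\boldsymbol\omega\in\{0,1\}^\ell$, together with $0$, listed in increasing order; i.e. $b_k=\tan(k\theta_\ell)$ for $k=0,1,\dots,2^\ell$.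
   Context: For $\boldsymbol\omega\in\{0,1\}^\ell$, $\mathscr{Q}(\boldsymbol\omega)=\sum_{k=1}^\ell2^{\ell-k}\left[\left(\sum_{t=1}^k\omega_t\right)\bmod2\right]$, and $\operatorname{Rot}(\theta)=\begin{bmatrix}\cos\theta&\sin\theta\\-\sin\theta&\cos\theta\end{bmatrix}$. $\operatorname{BNRot}_{\{\theta_k\}}(\psi)$ is the set of $(y,z,\boldsymbol\delta)\in\mathscr{B}\times\{0,1\}^\ell$ for which there exist reals $\xi_0,\dots,\xi_\ell$, $\eta_0,\dots,\eta_\ell$, $\tilde\eta_1,\dots,\tilde\eta_\ell$ with $\xi_0=z$, $\eta_0=y$ and, for every $k\in\{1,\dots,\ell\}$, $$\begin{bmatrix}\xi_k\\\tilde\eta_k\end{bmatrix}=\operatorname{Rot}(\theta_k)\begin{bmatrix}\xi_{k-1}\\\eta_{k-1}\end{bmatrix},\qquad\tilde\eta_k\le\eta_k\le\tilde\eta_k+\mathscr{M}_k\delta_k,\qquad-\tilde\eta_k\le\eta_k\le-\tilde\eta_k+\mathscr{M}_k(1-\delta_k).$$ $\operatorname{BNStep}_{\{\theta_k\}}(\psi)$ is the set of $(y,z,\boldsymbol\delta,f)\in\operatorname{BNRot}_{\{\theta_k\}}(\psi)\times\mathbb{R}$ with $$f\le\overline f_{\boldsymbol\omega}+\mathscr{N}_{\boldsymbol\omega}\|\boldsymbol\delta-\boldsymbol\omega\|_1\quad\forall\boldsymbol\omega\in\{0,1\}^\ell,\qquad\overline f_{\boldsymbol\omega}=\phi\left(\tan(\theta_0-\mathscr{Q}(\boldsymbol\omega)\theta_\ell)\right).$$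 "Sufficiently large" means: $\mathscr{M}_k\ge2\sqrt{y^2+z^2}$ for all $(y,z)\in\mathscr{B}$ and all $k$, and $\mathscr{N}_{\boldsymbol\omega}\ge\phi(\tan\theta_0)-\overline f_{\boldsymbol\omega}$ for all $\boldsymbol\omega$. $\operatorname{step}_{\{b_k\}}(\phi)=\{(r,f)\in\mathscr{D}\times\mathbb{R}:\text{for all }k\in\{1,\dots,2^\ell\},\ \text{if }r\in[b_{k-1},b_k)\text{ then }f\le\phi(b_k)\}$. $\operatorname{proj}_{(r=y/z,f)}(S)=\{(y/z,f):(y,z,\boldsymbol\delta,f)\in S\text{ for some }\boldsymbol\delta\}$. *)

theory Defs
  imports "HOL-Analysis.Analysis"
begin

text \<open>
  Points of \<open>{0,1}\<^sup>l\<close> are functions on the index set \<open>{1..l}\<close>, extensional so that there are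
  exactly \<open>2 ^ l\<close> of them.
\<close>

definition binvecs :: "nat \<Rightarrow> (nat \<Rightarrow> nat) set" where
  "binvecs l = {1..l} \<rightarrow>\<^sub>E {0, 1}"

definition Qfun :: "nat \<Rightarrow> (nat \<Rightarrow> nat) \<Rightarrow> nat" where
  "Qfun l \<omega> = (\<Sum>k=1..l. 2 ^ (l - k) * ((\<Sum>t=1..k. \<omega> t) mod 2))"

definition Rot :: "real \<Rightarrow> real^2^2" where
  "Rot \<theta> = vector [vector [cos \<theta>, sin \<theta>], vector [- sin \<theta>, cos \<theta>]]"

definition l1_dist :: "nat \<Rightarrow> (nat \<Rightarrow> nat) \<Rightarrow> (nat \<Rightarrow> nat) \<Rightarrow> real" where
  "l1_dist l \<delta> \<omega> = (\<Sum>k=1..l. \<bar>real (\<delta> k) - real (\<omega> k)\<bar>)"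

text \<open>
  The set \<open>BNRot\<close> attached to \<open>\<psi>(y,z) = \<phi>(y/z)\<close> depends on \<open>\<psi>\<close> only through its domain \<open>B\<close>, and
  \<open>BNStep\<close> only through \<open>B\<close> and \<open>\<phi>\<close>; these are the arguments taken below.
  The entries of the sequences \<open>\<xi>\<close>, \<open>\<eta>\<close>, \<open>\<eta>t\<close> with index above \<open>l\<close>, and \<open>\<eta>t 0\<close>, are irrelevant.
\<close>

definition BNRot ::
  "nat \<Rightarrow> (nat \<Rightarrow> real) \<Rightarrow> (nat \<Rightarrow> real) \<Rightarrow> (real \<times> real) set
    \<Rightarrow> (real \<times> real \<times> (nat \<Rightarrow> nat)) set" where
  "BNRot l \<theta> M B = {(y, z, \<delta>). (y, z) \<in> B \<and> \<delta> \<in> binvecs l \<and>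
     (\<exists>\<xi> \<eta> \<eta>t :: nat \<Rightarrow> real. \<xi> 0 = z \<and> \<eta> 0 = y \<and>
       (\<forall>k\<in>{1..l}.
          (vector [\<xi> k, \<eta>t k] :: real^2) = Rot (\<theta> k) *v vector [\<xi> (k - 1), \<eta> (k - 1)] \<and>
          \<eta>t k \<le> \<eta> k \<and> \<eta> k \<le> \<eta>t k + M k * real (\<delta> k) \<and>
          - \<eta>t k \<le> \<eta> k \<and> \<eta> k \<le> - \<eta>t k + M k * (1 - real (\<delta> k))))}"

definition fbar :: "nat \<Rightarrow> (nat \<Rightarrow> real) \<Rightarrow> (real \<Rightarrow> real) \<Rightarrow> (nat \<Rightarrow> nat) \<Rightarrow> real" where
  "fbar l \<theta> \<phi> \<omega> = \<phi> (tan (\<theta> 0 - real (Qfun l \<omega>) * \<theta> l))"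

definition BNStep ::
  "nat \<Rightarrow> (nat \<Rightarrow> real) \<Rightarrow> (nat \<Rightarrow> real) \<Rightarrow> ((nat \<Rightarrow> nat) \<Rightarrow> real) \<Rightarrow> (real \<times> real) set
    \<Rightarrow> (real \<Rightarrow> real) \<Rightarrow> (real \<times> real \<times> (nat \<Rightarrow> nat) \<times> real) set" where
  "BNStep l \<theta> M N B \<phi> = {(y, z, \<delta>, f). (y, z, \<delta>) \<in> BNRot l \<theta> M B \<and>
     (\<forall>\<omega>\<in>binvecs l. f \<le> fbar l \<theta> \<phi> \<omega> + N \<omega> * l1_dist l \<delta> \<omega>)}"

definition step_set ::
  "nat \<Rightarrow> (nat \<Rightarrow> real) \<Rightarrow> real set \<Rightarrow> (real \<Rightarrow> real) \<Rightarrow> (real \<times> real) set" where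
  "step_set n b D \<phi> = {(r, f). r \<in> D \<and> (\<forall>k\<in>{1..n}. r \<in> {b (k - 1)..<b k} \<longrightarrow> f \<le> \<phi> (b k))}"

definition proj_ratio :: "(real \<times> real \<times> 'd \<times> real) set \<Rightarrow> (real \<times> real) set" where
  "proj_ratio S = {(y / z, f) | y z \<delta> f. (y, z, \<delta>, f) \<in> S}"

definition breakpoint_set :: "nat \<Rightarrow> (nat \<Rightarrow> real) \<Rightarrow> real set" where
  "breakpoint_set l \<theta> = insert 0 ((\<lambda>\<omega>. tan (\<theta> 0 - real (Qfun l \<omega>) * \<theta> l)) ` binvecs l)"

definition breakpoint :: "nat \<Rightarrow> (nat \<Rightarrow> real) \<Rightarrow> nat \<Rightarrow> real" where
  "breakpoint l \<theta> k = sorted_list_of_set (breakpoint_set l \<theta>) ! k"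

end

theory Submission
  imports Defs
begin

text \<open>
  Write \<open>(z, y) = \<rho> (cos \<alpha>, sin \<alpha>)\<close> with \<open>\<alpha> = arctan (y / z)\<close> in \<open>[0, \<theta> 0)\<close>. Step \<open>k\<close> of the system
  rotates the current point by \<open>- \<theta> k\<close>, and the big-M inequalities then replace the second
  coordinate by its absolute value: they say \<open>\<eta> k = \<bar>\<eta>t k\<bar>\<close>, where \<open>\<delta> k\<close> records the sign of \<open>\<eta>t k\<close>
  and is free exactly when \<open>\<eta>t k = 0\<close>. In terms of the polar angle this is the folding
  \<open>a \<mapsto> \<bar>a - \<theta> k\<bar>\<close> of \<open>[0, 2 * \<theta> k]\<close> about its midpoint, that is, one step of a bisection in which
  the orientation flips at each reflection. The recorded bits are therefore a Gray code word for
  the dyadic interval that contains \<open>\<alpha>\<close>, and \<open>Qfun\<close> decodes it, since the partial sum parities of a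
  Gray code word are the binary digits of the number that it encodes.

  To make this exact, \<open>residual\<close> gives the folded angle in closed form for an arbitrary bit vector,
  and \<open>residual_Suc\<close> says that each folding step turns one residual into the next. Hence
  \<open>(y, z, \<delta>)\<close> solves the system iff \<open>\<alpha>\<close> lies in the closed interval
  \<open>[\<theta> 0 - (Q + 1) * \<theta> l, \<theta> 0 - Q * \<theta> l]\<close> with \<open>Q = Qfun l \<delta>\<close> (\<open>BNRot_iff_cell\<close>).

  The constants \<open>N\<close> are so large that, among the inequalities on \<open>f\<close>, only the one for \<open>\<omega> = \<delta>\<close>
  restricts it (\<open>bound_all_iff_bound_own\<close>): it is \<open>f \<le> \<phi> (b (2 ^ l - Q))\<close>, the value of \<open>\<phi>\<close> at the
  breakpoint \<open>b k = tan (k * \<theta> l)\<close> for the right end of that interval. At a breakpoint between two intervals there are two admissible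
  \<open>\<delta>\<close>. The one for the left interval gives the stronger bound because \<open>\<phi>\<close> is monotone, so the union
  over \<open>\<delta>\<close> is governed by the right interval, which is why the pieces of \<open>step_set\<close> are closed on the
  left and open on the right.
\<close>

section \<open>The Gray code\<close>

lemma Qfun_0 [simp]: "Qfun 0 \<omega> = 0"
  by (simp add: Qfun_def)

lemma Qfun_Suc_prefix_sum: "Qfun (Suc k) \<omega> = 2 * Qfun k \<omega> + (\<Sum>t=1..Suc k. \<omega> t) mod 2"
proof -
  have "(\<Sum>i=1..k. 2 ^ (Suc k - i) * ((\<Sum>t=1..i. \<omega> t) mod 2)) = 2 * Qfun k \<omega>"
    unfolding Qfun_def sum_distrib_left
    by (rule sum.cong) (simp_all add: Suc_diff_le mult.assoc del: sum.cl_ivl_Suc)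
  then show ?thesis
    unfolding Qfun_def[of "Suc k"] by simp
qed

text \<open>In the defining sum every term but the last carries a positive power of 2.\<close>

lemma Qfun_parity: "Qfun k \<omega> mod 2 = (\<Sum>t=1..k. \<omega> t) mod 2"
proof (cases k)
  case (Suc n)
  have "(2 * q + s mod 2) mod 2 = s mod 2" for q s :: nat
    by simp
  then show ?thesis
    unfolding Suc Qfun_Suc_prefix_sum .
qed simp

text \<open>
  The recursion behind everything that follows: a further bit \<open>0\<close> keeps the parity of the value and a
  bit \<open>1\<close> changes it, whereas the value itself is doubled, with the new parity as its last binary digit.
\<close>

lemma Qfun_Suc: "Qfun (Suc k) \<omega> = 2 * Qfun k \<omega> + (Qfun k \<omega> + \<omega> (Suc k)) mod 2"
proof -
  have "(\<Sum>t=1..Suc k. \<omega> t) mod 2 = (Qfun k \<omega> + \<omega> (Suc k)) mod 2"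
    using mod_add_cong[OF Qfun_parity[of k \<omega>] refl, of "\<omega> (Suc k)"] by simp
  then show ?thesis
    unfolding Qfun_Suc_prefix_sum by simp
qed

lemma Qfun_less: "Qfun l \<omega> < 2 ^ l"
proof (induction l)
  case (Suc l)
  have "(Qfun l \<omega> + \<omega> (Suc l)) mod 2 \<le> 1"
    by linarith
  then show ?case
    unfolding Qfun_Suc power_Suc using Suc by linarith
qed simp

lemma Qfun_cong: "(\<And>t. t \<in> {1..l} \<Longrightarrow> \<omega> t = \<omega>' t) \<Longrightarrow> Qfun l \<omega> = Qfun l \<omega>'"
  by (induction l) (auto simp: Qfun_Suc)

text \<open>
  Encoding by halving: the first \<open>l\<close> bits encode \<open>j div 2\<close>, and the last one says whether
  \<open>j\<close> and \<open>j div 2\<close> differ in parity.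
\<close>

lemma Qfun_surj: "j < 2 ^ l \<Longrightarrow> \<exists>\<omega>\<in>binvecs l. Qfun l \<omega> = j"
proof (induction l arbitrary: j)
  case 0
  then show ?case by (auto simp: binvecs_def)
next
  case (Suc l)
  then obtain \<omega> where \<omega>: "\<omega> \<in> binvecs l" "Qfun l \<omega> = j div 2"
    by (metis less_mult_imp_div_less mult.commute power_Suc)
  define \<omega>' where "\<omega>' = fun_upd \<omega> (Suc l) ((j + j div 2) mod 2)"
  have "\<omega>' \<in> binvecs (Suc l)"
    using \<omega>(1) unfolding binvecs_def \<omega>'_def
    by (auto simp: PiE_iff extensional_def)
  moreover have "Qfun (Suc l) \<omega>' = j"
  proof -
    define q where "q = j div 2"
    have "Qfun l \<omega>' = q"
      using Qfun_cong[of l \<omega>' \<omega>] \<omega>(2) by (simp add: \<omega>'_def q_def)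
    moreover have "(q + (j + q) mod 2) mod 2 = j mod 2"
    proof -
      have "(q + (j + q) mod 2) mod 2 = (q + (j + q)) mod 2"
        by (rule mod_add_right_eq)
      also have "q + (j + q) = j + 2 * q" by simp
      finally show ?thesis by (simp only: mod_mult_self2)
    qed
    moreover have "\<omega>' (Suc l) = (j + q) mod 2"
      by (simp add: \<omega>'_def q_def)
    ultimately have "Qfun (Suc l) \<omega>' = 2 * q + j mod 2"
      by (simp only: Qfun_Suc)
    then show ?thesis
      by (simp only: q_def mult_div_mod_eq)
  qed
  ultimately show ?case by blast
qed

lemma Qfun_image: "Qfun l ` binvecs l = {..<2 ^ l}"
proof
  show "Qfun l ` binvecs l \<subseteq> {..<2 ^ l}"
    using Qfun_less by blast
  show "{..<2 ^ l} \<subseteq> Qfun l ` binvecs l"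
    using Qfun_surj by blast
qed

section \<open>Dyadic cells and residual angles\<close>

text \<open>
  The \<open>2 ^ k\<close> dyadic intervals of level \<open>k\<close> in \<open>[0, a]\<close>, numbered from the right starting with \<open>0\<close>,
  because \<open>Qfun\<close> counts down from \<open>\<theta> 0\<close>. They are closed, since a point where two of them meet is
  reached by the bit vectors of both.
\<close>

definition cell :: "real \<Rightarrow> nat \<Rightarrow> nat \<Rightarrow> real set" where
  "cell a k j = {a - real (j + 1) * (a / 2 ^ k) .. a - real j * (a / 2 ^ k)}"

text \<open>
  The distance of \<open>\<alpha>\<close> from the left end of the cell numbered \<open>Qfun k \<delta>\<close> if this number is even, and from
  its right end if it is odd, with the sign that is positive on the side of the cell.
  The alternation reflects that an odd number of reflections has reversed the orientation of the cell.
\<close>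

definition residual :: "real \<Rightarrow> (nat \<Rightarrow> nat) \<Rightarrow> real \<Rightarrow> nat \<Rightarrow> real" where
  "residual a \<delta> \<alpha> k =
     (if even (Qfun k \<delta>) then \<alpha> - (a - real (Qfun k \<delta> + 1) * (a / 2 ^ k))
      else a - real (Qfun k \<delta>) * (a / 2 ^ k) - \<alpha>)"

lemma residual_0 [simp]: "residual a \<delta> \<alpha> 0 = \<alpha>"
  by (simp add: residual_def)

lemma residual_in_iff_cell: "residual a \<delta> \<alpha> k \<in> {0..a / 2 ^ k} \<longleftrightarrow> \<alpha> \<in> cell a k (Qfun k \<delta>)"
proof -
  define u where "u = a / 2 ^ k"
  show ?thesis
    unfolding residual_def cell_def u_def[symmetric] by (auto simp: algebra_simps)
qed

text \<open>
  Rotating by half the length of a cell measures the angle from the midpoint of the cell. Of its two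
  halves, which are the cells of the next level, one keeps the orientation (bit \<open>0\<close>)
  and the other is reversed (bit \<open>1\<close>). The identity is purely algebraic, whichever half contains \<open>\<alpha>\<close>, and so
  serves both to analyse a given solution and to construct one.
\<close>

lemma residual_Suc:
  assumes "\<delta> (Suc k) \<in> {0, 1}"
  shows "residual a \<delta> \<alpha> k - a / 2 ^ Suc k = (- 1) ^ \<delta> (Suc k) * residual a \<delta> \<alpha> (Suc k)"
proof -
  define u where "u = a / 2 ^ Suc k"
  define q where "q = Qfun k \<delta>"
  have u: "a / 2 ^ k = 2 * u" by (simp add: u_def)
  have parity: "odd (2 * q + (q + \<delta> (Suc k)) mod 2) \<longleftrightarrow> odd (q + \<delta> (Suc k))"
    by simp
  show ?thesis
    unfolding residual_def Qfun_Suc u u_def[symmetric] q_def[symmetric] parity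
    using assms by (cases "even q") (auto simp: odd_iff_mod_2_eq_one mod_Suc algebra_simps)
qed

lemma cell_Suc_subset:
  assumes "a \<ge> 0" "j = 2 * i \<or> j = 2 * i + 1"
  shows "cell a (Suc k) j \<subseteq> cell a k i"
proof -
  define u where "u = a / 2 ^ Suc k"
  have u: "a / 2 ^ k = 2 * u" "u \<ge> 0" using assms(1) by (simp_all add: u_def)
  show ?thesis
    unfolding cell_def u(1) u_def[symmetric] using assms(2) u(2) by (auto simp: algebra_simps)
qed

lemma cell_Qfun_antimono:
  assumes "a \<ge> 0" "k \<le> l"
  shows "cell a l (Qfun l \<delta>) \<subseteq> cell a k (Qfun k \<delta>)"
  using assms(2)
proof (induction l rule: dec_induct)
  case (step n)
  have "Qfun (Suc n) \<delta> = 2 * Qfun n \<delta> \<or> Qfun (Suc n) \<delta> = 2 * Qfun n \<delta> + 1"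
    unfolding Qfun_Suc by linarith
  then show ?case
    using cell_Suc_subset[OF assms(1)] step.IH by blast
qed simp

section \<open>The rotation and folding system\<close>

lemma vector_eq_Rot_iff:
  "(vector [p, q] :: real^2) = Rot t *v vector [x, y] \<longleftrightarrow>
     p = cos t * x + sin t * y \<and> q = cos t * y - sin t * x"
  by (simp add: vec_eq_iff forall_2 Rot_def matrix_vector_mult_def sum_2)

text \<open>The first coordinate is the one that carries the cosine, so \<open>Rot t\<close> turns clockwise.\<close>

lemma Rot_polar:
  "(vector [p, q] :: real^2) = Rot t *v vector [\<rho> * cos b, \<rho> * sin b] \<longleftrightarrow>
     p = \<rho> * cos (b - t) \<and> q = \<rho> * sin (b - t)"
  unfolding vector_eq_Rot_iff by (simp add: sin_diff cos_diff algebra_simps)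

text \<open>
  By induction the point after \<open>k\<close> steps has polar angle \<open>residual (\<theta> 0) \<delta> \<alpha> k\<close>. The inequalities force
  \<open>\<eta> k \<ge> 0\<close>, and an angle of absolute value below \<open>pi / 2\<close> with nonnegative sine is nonnegative; so the residual
  lies in \<open>[0, \<theta> k]\<close>, and for \<open>k = l\<close> this says that \<open>\<alpha>\<close> lies in the cell.
\<close>

lemma BNRot_imp_cell:
  assumes "(y, z, \<delta>) \<in> BNRot l \<theta> M B"
    and pol: "z = \<rho> * cos \<alpha>" "y = \<rho> * sin \<alpha>" "\<rho> > 0"
    and a: "0 < \<theta> 0" "\<theta> 0 < pi / 2" "0 \<le> \<alpha>" "\<alpha> \<le> \<theta> 0"
    and th: "\<And>k. k \<le> l \<Longrightarrow> \<theta> k = \<theta> 0 / 2 ^ k"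
  shows "\<alpha> \<in> cell (\<theta> 0) l (Qfun l \<delta>)"
proof -
  from assms(1) obtain \<xi> \<eta> \<eta>t :: "nat \<Rightarrow> real" where
    dl: "\<delta> \<in> binvecs l" and init: "\<xi> 0 = z" "\<eta> 0 = y"
    and sys: "\<And>k. k \<in> {1..l} \<Longrightarrow>
          (vector [\<xi> k, \<eta>t k] :: real^2) = Rot (\<theta> k) *v vector [\<xi> (k - 1), \<eta> (k - 1)] \<and>
          \<eta>t k \<le> \<eta> k \<and> \<eta> k \<le> \<eta>t k + M k * real (\<delta> k) \<and>
          - \<eta>t k \<le> \<eta> k \<and> \<eta> k \<le> - \<eta>t k + M k * (1 - real (\<delta> k))"
    unfolding BNRot_def by blast
  let ?r = "residual (\<theta> 0) \<delta> \<alpha>"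
  have "k \<le> l \<Longrightarrow> \<xi> k = \<rho> * cos (?r k) \<and> \<eta> k = \<rho> * sin (?r k) \<and> ?r k \<in> {0..\<theta> 0 / 2 ^ k}" for k
  proof (induction k)
    case 0
    then show ?case using init pol a by simp
  next
    case (Suc k)
    let ?t = "\<theta> 0 / 2 ^ Suc k"
    have IH: "\<xi> k = \<rho> * cos (?r k)" "\<eta> k = \<rho> * sin (?r k)" "?r k \<in> {0..2 * ?t}"
      using Suc by auto
    have d01: "\<delta> (Suc k) \<in> {0, 1}"
      using dl Suc.prems unfolding binvecs_def by (auto simp: PiE_iff)
    note s = sys[of "Suc k", simplified, unfolded th[OF Suc.prems] IH(1,2) Rot_polar
        residual_Suc[of \<delta>, OF d01]]
    \<comment> \<open>Bit 0 forces \<open>\<eta> = \<eta>t\<close>, bit 1 forces \<open>\<eta> = - \<eta>t\<close>; \<open>\<eta> \<ge> 0\<close> because \<open>\<eta> \<ge> \<eta>t\<close> and \<open>\<eta> \<ge> - \<eta>t\<close>.\<close>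
    have step: "\<xi> (Suc k) = \<rho> * cos (?r (Suc k))"
        "\<eta> (Suc k) = \<rho> * sin (?r (Suc k))" "\<eta> (Suc k) \<ge> 0"
      using s Suc.prems d01 by auto
    have range: "?r (Suc k) \<in> {- ?t..?t}"
      using residual_Suc[of \<delta> k "\<theta> 0" \<alpha>, OF d01] IH(3) d01 by (auto simp del: power_Suc)
    have "?t \<le> \<theta> 0"
      using a(1) by (simp add: field_simps del: power_Suc)
    have "\<not> ?r (Suc k) < 0"
    proof
      assume "?r (Suc k) < 0"
      then have "sin (?r (Suc k)) < 0"
        using range \<open>?t \<le> \<theta> 0\<close> a(2) sin_gt_zero[of "- ?r (Suc k)"] by (simp del: power_Suc)
      then show False
        using step(2,3) pol(3) by (simp add: zero_le_mult_iff)
    qed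
    then show ?case using step range by simp
  qed
  then show ?thesis
    using residual_in_iff_cell by blast
qed

text \<open>
  Conversely, the residuals themselves give a solution. Cells are nested, so all of them are nonnegative,
  not just the last one; and \<open>M k \<ge> 2 * \<rho>\<close> leaves room for the slack \<open>2 * \<eta> k\<close>.
\<close>

lemma cell_imp_BNRot:
  assumes B: "(y, z) \<in> B" and dl: "\<delta> \<in> binvecs l"
    and cell: "\<alpha> \<in> cell (\<theta> 0) l (Qfun l \<delta>)"
    and pol: "z = \<rho> * cos \<alpha>" "y = \<rho> * sin \<alpha>" "\<rho> > 0"
    and a: "0 < \<theta> 0" "\<theta> 0 < pi / 2"
    and th: "\<And>k. k \<le> l \<Longrightarrow> \<theta> k = \<theta> 0 / 2 ^ k"
    and M: "\<And>k. k \<in> {1..l} \<Longrightarrow> M k \<ge> 2 * \<rho>"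
  shows "(y, z, \<delta>) \<in> BNRot l \<theta> M B"
proof -
  let ?r = "residual (\<theta> 0) \<delta> \<alpha>"
  define \<xi> where "\<xi> k = \<rho> * cos (?r k)" for k
  define \<eta> where "\<eta> k = \<rho> * sin (?r k)" for k
  define \<eta>t where "\<eta>t k = (- 1) ^ \<delta> k * \<eta> k" for k
  have sys: "(vector [\<xi> k, \<eta>t k] :: real^2) = Rot (\<theta> k) *v vector [\<xi> (k - 1), \<eta> (k - 1)] \<and>
          \<eta>t k \<le> \<eta> k \<and> \<eta> k \<le> \<eta>t k + M k * real (\<delta> k) \<and>
          - \<eta>t k \<le> \<eta> k \<and> \<eta> k \<le> - \<eta>t k + M k * (1 - real (\<delta> k))" if k: "k \<in> {1..l}" for k
  proof -
    obtain n where n: "k = Suc n" using k by (cases k) auto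
    have d01: "\<delta> k \<in> {0, 1}"
      using dl k unfolding binvecs_def by (auto simp: PiE_iff)
    have "\<alpha> \<in> cell (\<theta> 0) k (Qfun k \<delta>)"
      using cell_Qfun_antimono[of "\<theta> 0" k l \<delta>] a k cell by auto
    then have "?r k \<in> {0..\<theta> 0 / 2 ^ k}"
      using residual_in_iff_cell by blast
    moreover have "\<theta> 0 / 2 ^ k \<le> \<theta> 0"
      using a(1) by (simp add: field_simps)
    ultimately have "sin (?r k) \<ge> 0"
      using a by (intro sin_ge_zero) auto
    then have "0 \<le> \<eta> k" "\<eta> k \<le> \<rho>"
      using pol(3) by (simp_all add: \<eta>_def mult_left_le)
    then have eta: "0 \<le> \<eta> k" "2 * \<eta> k \<le> M k"
      using M[OF k] by linarith+
    have "\<xi> k = \<rho> * cos (?r n - \<theta> k) \<and> \<eta>t k = \<rho> * sin (?r n - \<theta> k)"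
      using d01 k th[of k] residual_Suc[of \<delta> n "\<theta> 0" \<alpha>]
      unfolding \<eta>t_def \<xi>_def \<eta>_def n by (auto simp del: power_Suc)
    then have "(vector [\<xi> k, \<eta>t k] :: real^2) = Rot (\<theta> k) *v vector [\<xi> n, \<eta> n]"
      unfolding \<xi>_def[of n] \<eta>_def[of n] Rot_polar .
    moreover have "n = k - 1" by (simp add: n)
    moreover have "\<eta>t k \<le> \<eta> k \<and> \<eta> k \<le> \<eta>t k + M k * real (\<delta> k) \<and>
        - \<eta>t k \<le> \<eta> k \<and> \<eta> k \<le> - \<eta>t k + M k * (1 - real (\<delta> k))"
      using eta d01 by (auto simp: \<eta>t_def)
    ultimately show ?thesis by blast
  qed
  have "\<xi> 0 = z" "\<eta> 0 = y"
    by (simp_all add: \<xi>_def \<eta>_def pol)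
  with sys have "\<exists>\<xi> \<eta> \<eta>t :: nat \<Rightarrow> real. \<xi> 0 = z \<and> \<eta> 0 = y \<and>
       (\<forall>k\<in>{1..l}.
          (vector [\<xi> k, \<eta>t k] :: real^2) = Rot (\<theta> k) *v vector [\<xi> (k - 1), \<eta> (k - 1)] \<and>
          \<eta>t k \<le> \<eta> k \<and> \<eta> k \<le> \<eta>t k + M k * real (\<delta> k) \<and>
          - \<eta>t k \<le> \<eta> k \<and> \<eta> k \<le> - \<eta>t k + M k * (1 - real (\<delta> k)))"
    by - (rule exI[of _ \<xi>], rule exI[of _ \<eta>], rule exI[of _ \<eta>t], blast)
  then show ?thesis
    using B dl by (simp only: BNRot_def mem_Collect_eq case_prod_conv simp_thms)
qed

text \<open>
  This eliminates the auxiliary sequences: all that remains of the system is which cell contains the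
  polar angle.
\<close>

lemma BNRot_iff_cell:
  assumes B: "(y, z) \<in> B" and "y \<ge> 0" "z > 0" "y / z \<le> tan (\<theta> 0)"
    and a: "0 < \<theta> 0" "\<theta> 0 < pi / 2"
    and th: "\<And>k. k \<le> l \<Longrightarrow> \<theta> k = \<theta> 0 / 2 ^ k"
    and M: "\<And>k. k \<in> {1..l} \<Longrightarrow> M k \<ge> 2 * sqrt (y\<^sup>2 + z\<^sup>2)"
  shows "(y, z, \<delta>) \<in> BNRot l \<theta> M B \<longleftrightarrow>
    \<delta> \<in> binvecs l \<and> arctan (y / z) \<in> cell (\<theta> 0) l (Qfun l \<delta>)"
proof -
  define \<alpha> where "\<alpha> = arctan (y / z)"
  define \<rho> where "\<rho> = sqrt (y\<^sup>2 + z\<^sup>2)"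
  have "\<rho> > 0"
    using \<open>z > 0\<close> by (simp add: \<rho>_def add_nonneg_pos)
  \<comment> \<open>\<open>h\<close> is the secant of \<open>\<alpha>\<close>.\<close>
  define h where "h = sqrt (1 + (y / z)\<^sup>2)"
  have "h > 0"
    unfolding h_def by (simp add: add_pos_nonneg)
  have "y\<^sup>2 + z\<^sup>2 = z\<^sup>2 * (1 + (y / z)\<^sup>2)"
    using \<open>z > 0\<close> by (simp add: power_divide distrib_left)
  then have "\<rho> = z * h"
    unfolding \<rho>_def h_def using \<open>z > 0\<close> by (simp only: real_sqrt_mult real_sqrt_abs abs_of_pos)
  moreover have "cos \<alpha> = 1 / h" "sin \<alpha> = y / z / h"
    unfolding \<alpha>_def h_def by (rule cos_arctan sin_arctan)+
  ultimately have pol: "z = \<rho> * cos \<alpha>" "y = \<rho> * sin \<alpha>"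
    using \<open>z > 0\<close> \<open>h > 0\<close> by simp_all
  have "0 \<le> \<alpha>" "\<alpha> \<le> \<theta> 0"
  proof -
    show "0 \<le> \<alpha>"
      using assms(2,3) by (simp add: \<alpha>_def)
    have "arctan (tan (\<theta> 0)) = \<theta> 0"
      using a by (intro arctan_tan) linarith+
    then show "\<alpha> \<le> \<theta> 0"
      using arctan_monotone'[OF assms(4)] by (simp only: \<alpha>_def)
  qed
  have "arctan (y / z) \<in> cell (\<theta> 0) l (Qfun l \<delta>)" if "(y, z, \<delta>) \<in> BNRot l \<theta> M B"
    unfolding \<alpha>_def[symmetric]
    using that pol \<open>\<rho> > 0\<close> a \<open>0 \<le> \<alpha>\<close> \<open>\<alpha> \<le> \<theta> 0\<close> th
    by (rule BNRot_imp_cell[where \<theta> = \<theta>])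
  moreover have "(y, z, \<delta>) \<in> BNRot l \<theta> M B"
    if "\<delta> \<in> binvecs l" "arctan (y / z) \<in> cell (\<theta> 0) l (Qfun l \<delta>)"
    using B that(1) that(2)[folded \<alpha>_def] pol \<open>\<rho> > 0\<close> a th M[folded \<rho>_def]
    by (rule cell_imp_BNRot[where \<theta> = \<theta>])
  moreover have "\<delta> \<in> binvecs l" if "(y, z, \<delta>) \<in> BNRot l \<theta> M B"
    using that by (simp add: BNRot_def)
  ultimately show ?thesis by blast
qed

section \<open>Breakpoints\<close>

lemma nth_sorted_list_of_set_strict_mono_image:
  fixes g :: "nat \<Rightarrow> 'a::linorder"
  assumes "strict_mono_on {..n} g" "k \<le> n"
  shows "sorted_list_of_set (g ` {..n}) ! k = g k"
proof -
  have "sorted_wrt (<) (map g [0..<Suc n])"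
    using assms(1) by (auto simp: sorted_wrt_map sorted_wrt_iff_nth_less strict_mono_on_def simp del: upt_Suc)
  then have "sorted_list_of_set (set (map g [0..<Suc n])) = map g [0..<Suc n]"
    using sorted_list_of_set.idem_if_sorted_distinct strict_sorted_iff by blast
  moreover have "set (map g [0..<Suc n]) = g ` {..n}"
    by (simp add: atLeast0LessThan lessThan_Suc_atMost del: upt_Suc)
  ultimately show ?thesis
    using assms(2) by (simp del: upt_Suc)
qed

lemma strict_mono_on_tan_multiples:
  assumes "0 < t" "real n * t < pi / 2"
  shows "strict_mono_on {..n} (\<lambda>k. tan (real k * t))"
proof (rule strict_mono_onI)
  fix i j assume "i \<in> {..n}" "j \<in> {..n}" "i < j"
  then have "real i * t < real j * t" "real j * t \<le> real n * t" "0 \<le> real i * t"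
    using assms(1) by auto
  then show "tan (real i * t) < tan (real j * t)"
    using assms(2) by (intro tan_monotone) auto
qed

text \<open>This turns the count from the right, starting at \<open>\<theta> 0\<close>, into a count from the left, starting at \<open>0\<close>.\<close>

lemma tan_Qfun_eq:
  assumes "\<theta> 0 = 2 ^ l * \<theta> l"
  shows "tan (\<theta> 0 - real (Qfun l \<omega>) * \<theta> l) = tan (real (2 ^ l - Qfun l \<omega>) * \<theta> l)"
  using Qfun_less[of l \<omega>] by (simp add: assms of_nat_diff algebra_simps)

text \<open>
  Every number below \<open>2 ^ l\<close> is a value of \<open>Qfun\<close>, so the bit vectors account for all positive multiples of
  \<open>\<theta> l\<close> up to \<open>\<theta> 0\<close>; only the breakpoint \<open>0\<close> has to be added.
\<close>

lemma breakpoint_set_eq: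
  assumes "\<theta> 0 = 2 ^ l * \<theta> l"
  shows "breakpoint_set l \<theta> = (\<lambda>k. tan (real k * \<theta> l)) ` {..2 ^ l}"
proof -
  have "(\<lambda>j. 2 ^ l - j) ` {..<2 ^ l} = {0<..(2::nat) ^ l}"
  proof (rule set_eqI, rule iffI)
    fix k :: nat assume "k \<in> {0<..2 ^ l}"
    then have "2 ^ l - k \<in> {..<2 ^ l}" "k = 2 ^ l - (2 ^ l - k)" by auto
    then show "k \<in> (\<lambda>j. 2 ^ l - j) ` {..<2 ^ l}" by blast
  qed auto
  then have "(\<lambda>\<omega>. 2 ^ l - Qfun l \<omega>) ` binvecs l = {0<..2 ^ l}"
    using Qfun_image[of l] by (simp flip: image_image[of "\<lambda>j. 2 ^ l - j" "Qfun l"])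
  then have "(\<lambda>\<omega>. tan (\<theta> 0 - real (Qfun l \<omega>) * \<theta> l)) ` binvecs l
      = (\<lambda>k. tan (real k * \<theta> l)) ` {0<..2 ^ l}"
    unfolding tan_Qfun_eq[of \<theta> l, OF assms]
    by (simp flip: image_image[of "\<lambda>k. tan (real k * \<theta> l)" "\<lambda>\<omega>. 2 ^ l - Qfun l \<omega>"])
  moreover have "{..(2::nat) ^ l} = insert 0 {0<..2 ^ l}" by auto
  ultimately show ?thesis
    by (simp add: breakpoint_set_def)
qed

section \<open>The step inequalities\<close>

lemma l1_dist_self [simp]: "l1_dist l \<delta> \<delta> = 0"
  by (simp add: l1_dist_def)

lemma l1_dist_ge_1:
  assumes "\<delta> \<in> binvecs l" "\<omega> \<in> binvecs l" "\<delta> \<noteq> \<omega>"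
  shows "l1_dist l \<delta> \<omega> \<ge> 1"
proof -
  obtain k where k: "k \<in> {1..l}" "\<delta> k \<noteq> \<omega> k"
    using assms PiE_ext unfolding binvecs_def by metis
  have "1 \<le> \<bar>real (\<delta> k) - real (\<omega> k)\<bar>"
    using k(2) by linarith
  also have "\<dots> \<le> l1_dist l \<delta> \<omega>"
    unfolding l1_dist_def using k(1) by (intro member_le_sum) auto
  finally show ?thesis .
qed

text \<open>
  Distinct bit vectors have distance at least 1, so a vector \<open>\<omega> \<noteq> \<delta>\<close> contributes a bound of at least
  \<open>F \<omega> + N \<omega> \<ge> c \<ge> F \<delta>\<close>. Here \<open>F \<omega> \<le> c\<close> also ensures \<open>N \<omega> \<ge> 0\<close>.
\<close>

lemma bound_all_iff_bound_own:
  fixes F N :: "(nat \<Rightarrow> nat) \<Rightarrow> real"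
  assumes "\<delta> \<in> binvecs l"
    and "\<And>\<omega>. \<omega> \<in> binvecs l \<Longrightarrow> F \<omega> \<le> c \<and> c - F \<omega> \<le> N \<omega>"
  shows "(\<forall>\<omega>\<in>binvecs l. f \<le> F \<omega> + N \<omega> * l1_dist l \<delta> \<omega>) \<longleftrightarrow> f \<le> F \<delta>"
proof
  assume f: "f \<le> F \<delta>"
  show "\<forall>\<omega>\<in>binvecs l. f \<le> F \<omega> + N \<omega> * l1_dist l \<delta> \<omega>"
  proof
    fix \<omega> assume \<omega>: "\<omega> \<in> binvecs l"
    show "f \<le> F \<omega> + N \<omega> * l1_dist l \<delta> \<omega>"
    proof (cases "\<delta> = \<omega>")
      case False
      have "N \<omega> * 1 \<le> N \<omega> * l1_dist l \<delta> \<omega>"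
        using assms(2)[OF \<omega>] l1_dist_ge_1[OF assms(1) \<omega> False] by (intro mult_left_mono) auto
      then show ?thesis
        using f assms(2)[OF \<omega>] assms(2)[OF assms(1)] by linarith
    qed (use f in simp)
  qed
next
  assume "\<forall>\<omega>\<in>binvecs l. f \<le> F \<omega> + N \<omega> * l1_dist l \<delta> \<omega>"
  from bspec[OF this assms(1)] show "f \<le> F \<delta>"
    by simp
qed

theorem proposition14:
  fixes B :: "(real \<times> real) set" and D S :: "real set" and l :: nat
    and \<theta> M :: "nat \<Rightarrow> real" and N :: "(nat \<Rightarrow> nat) \<Rightarrow> real" and \<phi> :: "real \<Rightarrow> real"
  assumes "\<forall>(y, z)\<in>B. y \<ge> 0 \<and> z > 0"
    and "D = {y / z | y z. (y, z) \<in> B}"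
    and "l \<ge> 1"
    and "0 < \<theta> 0" and "\<theta> 0 < pi / 2"
    and "D \<subseteq> {0..<tan (\<theta> 0)}"
    and "\<forall>k\<in>{1..l}. \<theta> k = \<theta> 0 / 2 ^ k"
    and "{0..tan (\<theta> 0)} \<subseteq> S" and "mono_on S \<phi>"
    and "\<forall>k\<in>{1..l}. \<forall>(y, z)\<in>B. M k \<ge> 2 * sqrt (y\<^sup>2 + z\<^sup>2)"
    and "\<forall>\<omega>\<in>binvecs l. N \<omega> \<ge> \<phi> (tan (\<theta> 0)) - fbar l \<theta> \<phi> \<omega>"
  shows "proj_ratio (BNStep l \<theta> M N B \<phi>) = step_set (2 ^ l) (breakpoint l \<theta>) D \<phi>
    \<and> card (breakpoint_set l \<theta>) = 2 ^ l + 1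
    \<and> (\<forall>k\<in>{0..2 ^ l}. breakpoint l \<theta> k = tan (real k * \<theta> l))"
proof -
  have th: "\<theta> k = \<theta> 0 / 2 ^ k" if "k \<le> l" for k
    using assms(7) that by (cases k) auto
  define t where "t = \<theta> l"
  define b where "b k = tan (real k * t)" for k
  have th0: "\<theta> 0 = 2 ^ l * t" and t: "0 < t"
    using th[of l] assms(4) by (simp_all add: t_def)
  have b_top: "b (2 ^ l) = tan (\<theta> 0)"
    by (simp add: b_def th0)
  have mono: "strict_mono_on {..2 ^ l} b"
    unfolding b_def using t assms(5) th0 by (intro strict_mono_on_tan_multiples) auto
  have set_eq: "breakpoint_set l \<theta> = b ` {..2 ^ l}"
    using breakpoint_set_eq[of \<theta> l] th0 unfolding b_def t_def by simp
  have card: "card (breakpoint_set l \<theta>) = 2 ^ l + 1"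
    unfolding set_eq using card_image[OF strict_mono_on_imp_inj_on[OF mono]] by simp
  have bp: "breakpoint l \<theta> k = b k" if "k \<le> 2 ^ l" for k
    using nth_sorted_list_of_set_strict_mono_image[OF mono that]
    by (simp add: breakpoint_def set_eq)
  have \<phi>_mono: "\<phi> (b i) \<le> \<phi> (b j)" if "i \<le> j" "j \<le> 2 ^ l" for i j
  proof -
    note le = strict_mono_on_leD[OF mono]
    have "b 0 = 0" by (simp add: b_def)
    then have "b i \<in> S" "b j \<in> S"
      using that le[of 0 i] le[of i "2 ^ l"] le[of 0 j] le[of j "2 ^ l"] assms(8) b_top by auto
    then show ?thesis
      using mono_onD[OF assms(9)] le[of i j] that by simp
  qed
  have fbar: "fbar l \<theta> \<phi> \<omega> = \<phi> (b (2 ^ l - Qfun l \<omega>))" for \<omega>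
    using tan_Qfun_eq[of \<theta> l \<omega>] th0 by (simp add: fbar_def b_def t_def)
  have BNStep: "(y, z, \<delta>, f) \<in> BNStep l \<theta> M N B \<phi> \<longleftrightarrow>
      (y, z) \<in> B \<and> \<delta> \<in> binvecs l \<and> arctan (y / z) \<in> cell (\<theta> 0) l (Qfun l \<delta>)
        \<and> f \<le> \<phi> (b (2 ^ l - Qfun l \<delta>))" for y z \<delta> f
  proof (cases "(y, z) \<in> B \<and> \<delta> \<in> binvecs l")
    case True
    have "y / z \<in> D" using True assms(2) by blast
    then have "y / z \<le> tan (\<theta> 0)" using assms(6) by auto
    moreover have "y \<ge> 0" "z > 0" "\<And>k. k \<in> {1..l} \<Longrightarrow> M k \<ge> 2 * sqrt (y\<^sup>2 + z\<^sup>2)"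
      using True assms(1,10) by blast+
    ultimately have "(y, z, \<delta>) \<in> BNRot l \<theta> M B \<longleftrightarrow> arctan (y / z) \<in> cell (\<theta> 0) l (Qfun l \<delta>)"
      using BNRot_iff_cell[of y z B \<theta> l M \<delta>] True th assms(4,5) by blast
    moreover have "(\<forall>\<omega>\<in>binvecs l. f \<le> fbar l \<theta> \<phi> \<omega> + N \<omega> * l1_dist l \<delta> \<omega>) \<longleftrightarrow> f \<le> fbar l \<theta> \<phi> \<delta>"
    proof (rule bound_all_iff_bound_own[where c = "\<phi> (tan (\<theta> 0))"])
      fix \<omega> assume "\<omega> \<in> binvecs l"
      then show "fbar l \<theta> \<phi> \<omega> \<le> \<phi> (tan (\<theta> 0)) \<and> \<phi> (tan (\<theta> 0)) - fbar l \<theta> \<phi> \<omega> \<le> N \<omega>"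
        using assms(11) \<phi>_mono[of "2 ^ l - Qfun l \<omega>" "2 ^ l"] by (simp add: fbar b_top)
    qed (use True in simp)
    ultimately show ?thesis
      using True by (simp add: BNStep_def fbar)
  qed (auto simp: BNStep_def BNRot_def)
  have cell: "\<alpha> \<in> cell (\<theta> 0) l (Qfun l \<delta>) \<longleftrightarrow>
      \<alpha> \<in> {(real (2 ^ l - Qfun l \<delta>) - 1) * t..real (2 ^ l - Qfun l \<delta>) * t}" for \<alpha> \<delta>
    using Qfun_less[of l \<delta>] th0 by (simp add: cell_def of_nat_diff algebra_simps)
  have arctan_b: "arctan (b k) = real k * t" if "k \<le> 2 ^ l" for k
  proof -
    have "real k \<le> real (2 ^ l)"
      using that by (simp only: of_nat_le_iff)
    then have "real k * t \<le> 2 ^ l * t"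
      using t by simp
    moreover have "0 \<le> real k * t" using t by simp
    ultimately show ?thesis
      unfolding b_def using assms(5) th0 by (intro arctan_tan) auto
  qed
  \<comment> \<open>The pieces of the step function, read as half-open intervals of angles.\<close>
  have piece: "r \<in> {b (k - 1)..<b k} \<longleftrightarrow> arctan r \<in> {(real k - 1) * t..<real k * t}"
    if "k \<in> {1..2 ^ l}" for k r
  proof -
    have "arctan (b k) = real k * t" "arctan (b (k - 1)) = (real k - 1) * t"
      using that arctan_b[of k] arctan_b[of "k - 1"] by (auto simp: of_nat_diff)
    then show ?thesis
      using arctan_le_iff[of "b (k - 1)" r] arctan_less_iff[of r "b k"] by simp
  qed
  have "(r, f) \<in> proj_ratio (BNStep l \<theta> M N B \<phi>) \<longleftrightarrow>
        (r, f) \<in> step_set (2 ^ l) (breakpoint l \<theta>) D \<phi>" for r f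
  proof
    assume "(r, f) \<in> proj_ratio (BNStep l \<theta> M N B \<phi>)"
    then obtain y z \<delta> where yz: "r = y / z" "(y, z) \<in> B" "f \<le> \<phi> (b (2 ^ l - Qfun l \<delta>))"
      and low: "(real (2 ^ l - Qfun l \<delta>) - 1) * t \<le> arctan r"
      unfolding proj_ratio_def BNStep cell by auto
    have "f \<le> \<phi> (b k)" if k: "k \<in> {1..2 ^ l}" "r \<in> {b (k - 1)..<b k}" for k
    proof -
      \<comment> \<open>The cell meets the piece \<open>k\<close>, but may touch it only at its left end; then it is the cell to the left,
        and its bound is the stronger one.\<close>
      have "(real (2 ^ l - Qfun l \<delta>) - 1) * t < real k * t"
        using low k piece by auto
      then have "2 ^ l - Qfun l \<delta> \<le> k"
        using t by simp
      then show ?thesis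
        using yz(3) \<phi>_mono[of "2 ^ l - Qfun l \<delta>" k] k(1) by simp
    qed
    then show "(r, f) \<in> step_set (2 ^ l) (breakpoint l \<theta>) D \<phi>"
      using yz assms(2) bp by (auto simp: step_set_def)
  next
    assume step: "(r, f) \<in> step_set (2 ^ l) (breakpoint l \<theta>) D \<phi>"
    then have "r \<in> D" by (simp add: step_set_def)
    then obtain y z where yz: "r = y / z" "(y, z) \<in> B" and r: "r \<in> {0..<tan (\<theta> 0)}"
      using assms(2,6) by blast
    have "arctan r < arctan (b (2 ^ l))"
      using r by (simp add: b_top arctan_less_iff)
    then have ar: "0 \<le> arctan r" "arctan r < real (2 ^ l) * t"
      using r arctan_b[of "2 ^ l"] by (simp_all only: zero_le_arctan_iff atLeastLessThan_iff order_refl)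
    \<comment> \<open>The piece that contains \<open>r\<close>; its bit vector \<open>\<delta>\<close> encodes the cell that is the closure of this piece.\<close>
    define k where "k = Suc (nat \<lfloor>arctan r / t\<rfloor>)"
    have fl: "real k - 1 = of_int \<lfloor>arctan r / t\<rfloor>"
      using ar(1) t by (simp add: k_def)
    have "real k - 1 \<le> arctan r / t" "arctan r / t < real k"
      using fl by linarith+
    then have ark: "arctan r \<in> {(real k - 1) * t..<real k * t}"
      using t by (simp add: pos_le_divide_eq pos_divide_less_eq)
    then have "(real k - 1) * t < real (2 ^ l) * t"
      using ar by (simp only: atLeastLessThan_iff) linarith
    then have "real k - 1 < real (2 ^ l)"
      using t by (simp only: mult_less_cancel_right_pos)
    then have k: "k \<in> {1..2 ^ l}"
      by (simp only: atLeastAtMost_iff k_def) linarith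
    obtain \<delta> where \<delta>: "\<delta> \<in> binvecs l" "Qfun l \<delta> = 2 ^ l - k"
      using Qfun_surj[of "2 ^ l - k" l] k by auto
    have kd: "2 ^ l - Qfun l \<delta> = k"
      using \<delta>(2) k by auto
    have "breakpoint l \<theta> k = b k" "breakpoint l \<theta> (k - 1) = b (k - 1)"
      using k by (auto intro!: bp)
    then have "f \<le> \<phi> (b k)"
      using step k ark[folded piece[OF k]] unfolding step_set_def by force
    then have "(y, z, \<delta>, f) \<in> BNStep l \<theta> M N B \<phi>"
      unfolding BNStep cell kd using yz \<delta>(1) ark by auto
    then show "(r, f) \<in> proj_ratio (BNStep l \<theta> M N B \<phi>)"
      unfolding proj_ratio_def using yz(1) by blast
  qed
  then have "proj_ratio (BNStep l \<theta> M N B \<phi>) = step_set (2 ^ l) (breakpoint l \<theta>) D \<phi>"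
    by auto
  then show ?thesis
    using card bp by (auto simp: b_def t_def)
qed

end
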